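(* Let $d:\mathcal{A}\to A$ be a $\rho_\theta$-invariant derivation. Then there exists a unique function $\beta\in c_{\rm inc}$, with $\beta(-1)=0$, such that $$d(a)=[\beta(\mathbb{K}-1),a]$$ for all $a\in\mathcal{A}$. If moreover $d$ maps $\mathcal{A}$ into $\mathcal{A}$, then the corresponding function $\beta$ is eventually linear.
   Context: $\mathbb{N}$ is the set of nonnegative integers, $\{E_k\}$ the canonical basis of $\ell^2(\mathbb{N})$, $U$ the unilateral shift $UE_k=E_{k+1}$, $A$ the $C^*$-algebra generated by $U$ (Toeplitz algebra, or quantum disk), and $\mathcal{A}=\operatorname{Pol}(U,U^* )$ the dense $*$-subalgebra of polynomials in $U$ and $U^*$. For each $\theta\in[0,2\pi)$, $\rho_\theta:A\to A$ is the automorphism determined by $\rho_\theta(U)=e^{i\theta}U$, $\rho_\theta(U^* )=e^{-i\theta}U^*$; it maps $\mathcal{A}$ to itself. A derivation $d:\mathcal{A}\to A$ is a linear map with $d(ab)=a\,d(b)+d(a)\,b$; it is $\rho_\theta$-invariant if $\rho_\theta(d(a))=d(\rho_\theta(a))$ for all $a\in\mathcal{A}$ and all $\theta$. Functions $\beta:\mathbb{N}\to\mathbb{C}$ are extended by $\beta(-1):=0$. $c_{\rm inc}$ is the set of functions $\beta$ with convergent increments, i.e. such that the sequence $\{\beta(k)-\beta(k-1)\}_{k\ge0}$ is convergent; $\beta$ is eventually linear if $\{\beta(k)-\beta(k-1)\}_{k\ge 0}$ is eventually constant. $\beta(\mathbb{K}-1)$ is the (possibly unbounded) diagonal operator $\beta(\mathbb{K}-1)E_k=\beta(k-1)E_k$;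 the commutator $[\beta(\mathbb{K}-1),a]$ is computed on the linear span of the $E_k$, where it defines a bounded operator belonging to $A$ for $a\in\mathcal{A}$. *)

theory Defs
  imports "HOL-Analysis.Analysis"
begin

section \<open>The Hilbert space of square-summable sequences\<close>

typedef ell2 = "{x :: nat \<Rightarrow> complex. summable (\<lambda>k. (cmod (x k))\<^sup>2)}"
  morphisms coord Abs_ell2
  by (rule exI[of _ "\<lambda>_. 0"]) simp

setup_lifting type_definition_ell2

lemma ell2_summable_mult:
  fixes x y :: "nat \<Rightarrow> complex"
  assumes "summable (\<lambda>k. (cmod (x k))\<^sup>2)" "summable (\<lambda>k. (cmod (y k))\<^sup>2)"
  shows "summable (\<lambda>k. cnj (x k) * y k)"
proof (rule summable_comparison_test')
  show "summable (\<lambda>k. (cmod (x k))\<^sup>2 + (cmod (y k))\<^sup>2)"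
    using assms by (rule summable_add)
  fix k
  have "cmod (x k) * cmod (y k) \<le> (cmod (x k))\<^sup>2 + (cmod (y k))\<^sup>2"
    using sum_squares_bound[of "cmod (x k)" "cmod (y k)"]
      mult_nonneg_nonneg[OF norm_ge_zero[of "x k"] norm_ge_zero[of "y k"]]
    by linarith
  then show "norm (cnj (x k) * y k) \<le> (cmod (x k))\<^sup>2 + (cmod (y k))\<^sup>2"
    by (simp add: norm_mult)
qed

lemma ell2_summable_add:
  fixes x y :: "nat \<Rightarrow> complex"
  assumes "summable (\<lambda>k. (cmod (x k))\<^sup>2)" "summable (\<lambda>k. (cmod (y k))\<^sup>2)"
  shows "summable (\<lambda>k. (cmod (x k + y k))\<^sup>2)"
proof (rule summable_comparison_test')
  show "summable (\<lambda>k. 2 * ((cmod (x k))\<^sup>2 + (cmod (y k))\<^sup>2))"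
    using assms by (intro summable_mult summable_add)
  fix k
  have "(cmod (x k + y k))\<^sup>2 \<le> (cmod (x k) + cmod (y k))\<^sup>2"
    by (intro power_mono norm_triangle_ineq) simp
  also have "\<dots> \<le> 2 * ((cmod (x k))\<^sup>2 + (cmod (y k))\<^sup>2)"
    using sum_squares_bound[of "cmod (x k)" "cmod (y k)"] by (simp add: power2_sum)
  finally show "norm ((cmod (x k + y k))\<^sup>2) \<le> 2 * ((cmod (x k))\<^sup>2 + (cmod (y k))\<^sup>2)"
    by simp
qed

lemma ell2_summable_scale:
  fixes x :: "nat \<Rightarrow> complex"
  assumes "summable (\<lambda>k. (cmod (x k))\<^sup>2)"
  shows "summable (\<lambda>k. (cmod (c * x k))\<^sup>2)"
  using summable_mult[OF assms, of "(cmod c)\<^sup>2"] by (simp add: norm_mult power_mult_distrib)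

lift_definition scaleC :: "complex \<Rightarrow> ell2 \<Rightarrow> ell2" (infixr "*\<^sub>C" 75)
  is "\<lambda>c x k. c * x k"
  by (rule ell2_summable_scale)

definition cinner :: "ell2 \<Rightarrow> ell2 \<Rightarrow> complex"
  where "cinner x y = (\<Sum>k. cnj (coord x k) * coord y k)"

lemma coord_summable: "summable (\<lambda>k. (cmod (coord x k))\<^sup>2)"
  using coord[of x] by simp

lemma cinner_summable: "summable (\<lambda>k. cnj (coord x k) * coord y k)"
  by (intro ell2_summable_mult coord_summable)

instantiation ell2 :: real_inner
begin

lift_definition zero_ell2 :: ell2 is "\<lambda>_. 0" by simp

lift_definition plus_ell2 :: "ell2 \<Rightarrow> ell2 \<Rightarrow> ell2" is "\<lambda>x y k. x k + y k"
  by (rule ell2_summable_add)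

lift_definition uminus_ell2 :: "ell2 \<Rightarrow> ell2" is "\<lambda>x k. - x k" by simp

definition minus_ell2 :: "ell2 \<Rightarrow> ell2 \<Rightarrow> ell2" where "minus_ell2 x y = x + - y"

definition scaleR_ell2 :: "real \<Rightarrow> ell2 \<Rightarrow> ell2"
  where "scaleR_ell2 r x = complex_of_real r *\<^sub>C x"

definition inner_ell2 :: "ell2 \<Rightarrow> ell2 \<Rightarrow> real"
  where "inner_ell2 x y = Re (cinner x y)"

definition norm_ell2 :: "ell2 \<Rightarrow> real" where "norm_ell2 x = sqrt (inner x x)"

definition sgn_ell2 :: "ell2 \<Rightarrow> ell2" where "sgn_ell2 x = complex_of_real (inverse (norm x)) *\<^sub>C x"

definition dist_ell2 :: "ell2 \<Rightarrow> ell2 \<Rightarrow> real" where "dist_ell2 x y = norm (x - y)"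

definition uniformity_ell2 :: "(ell2 \<times> ell2) filter"
  where "uniformity_ell2 = (INF e\<in>{0 <..}. principal {(x, y). dist x y < e})"

definition open_ell2 :: "ell2 set \<Rightarrow> bool"
  where "open_ell2 S = (\<forall>x\<in>S. \<forall>\<^sub>F (x', y) in uniformity. x' = x \<longrightarrow> y \<in> S)"

lemma inner_ell2_self: "inner x x = (\<Sum>k. (cmod (coord x k))\<^sup>2)" for x :: ell2
proof -
  have "Re (cinner x x) = (\<Sum>k. Re (cnj (coord x k) * coord x k))"
    unfolding cinner_def by (rule Re_suminf[OF cinner_summable])
  also have "\<dots> = (\<Sum>k. (cmod (coord x k))\<^sup>2)"
    unfolding cmod_power2 by (simp add: power2_eq_square)
  finally show ?thesis by (simp add: inner_ell2_def)
qed

instance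
proof
  fix x y z :: ell2 and a b r :: real
  show "x + y + z = x + (y + z)" "x + y = y + x" "0 + x = x" "- x + x = 0"
    by (transfer; simp add: fun_eq_iff add_ac)+
  show "x - y = x + - y" by (simp add: minus_ell2_def)
  show "a *\<^sub>R (x + y) = a *\<^sub>R x + a *\<^sub>R y" "(a + b) *\<^sub>R x = a *\<^sub>R x + b *\<^sub>R x"
    "a *\<^sub>R b *\<^sub>R x = (a * b) *\<^sub>R x" "1 *\<^sub>R x = x"
    unfolding scaleR_ell2_def by (transfer; simp add: fun_eq_iff algebra_simps)+
  show "sgn x = inverse (norm x) *\<^sub>R x" by (simp add: sgn_ell2_def scaleR_ell2_def)
  show "dist x y = norm (x - y)" by (simp add: dist_ell2_def)
  show "uniformity = (INF e\<in>{0 <..}. principal {(x::ell2, y). dist x y < e})"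
    by (simp add: uniformity_ell2_def)
  show "open S = (\<forall>x\<in>S. \<forall>\<^sub>F (x', y) in uniformity. x' = x \<longrightarrow> y \<in> S)" for S :: "ell2 set"
    by (simp add: open_ell2_def)
  have "Re (cinner x y) = (\<Sum>k. Re (cnj (coord x k) * coord y k))" for x y
    unfolding cinner_def by (rule Re_suminf[OF cinner_summable])
  then show "inner x y = inner y x"
    by (simp add: inner_ell2_def mult.commute)
  show "inner (x + y) z = inner x z + inner y z"
    using arg_cong[OF suminf_add[OF cinner_summable[of x z] cinner_summable[of y z]], of Re]
    by (simp only: inner_ell2_def cinner_def plus_ell2.rep_eq distrib_right plus_complex.sel
        complex_cnj_add)
  show "inner (r *\<^sub>R x) y = r * inner x y"
    using arg_cong[OF suminf_mult[OF cinner_summable[of x y], of "complex_of_real r"], of Re]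
    unfolding inner_ell2_def cinner_def scaleR_ell2_def scaleC.rep_eq complex_cnj_mult mult.assoc
      complex_cnj_complex_of_real
    by simp
  show "0 \<le> inner x x"
    unfolding inner_ell2_self by (rule suminf_nonneg[OF coord_summable]) simp
  show "inner x x = 0 \<longleftrightarrow> x = 0"
    unfolding inner_ell2_self
    by (subst suminf_eq_zero_iff[OF coord_summable]) (auto simp: coord_inject[symmetric] zero_ell2.rep_eq)
  show "norm x = sqrt (inner x x)" by (simp add: norm_ell2_def)
qed

end

lemma norm_ell2_eq: "norm x = sqrt (\<Sum>k. (cmod (coord x k))\<^sup>2)" for x :: ell2
  by (simp only: norm_ell2_def inner_ell2_self)

global_interpretation ell2: vector_space scaleC
  defines cspan = ell2.span
  by unfold_locales (transfer; simp add: fun_eq_iff algebra_simps)+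

lift_definition E :: "nat \<Rightarrow> ell2" is "\<lambda>k j. of_bool (j = k)"
proof -
  fix k :: nat
  show "summable (\<lambda>j. (cmod (of_bool (j = k)))\<^sup>2)"
    by (rule summable_finite[of "{k}"]) auto
qed


section \<open>Bounded operators\<close>

text \<open>
  The type of bounded linear maps is only real-linear; the bounded operators of the complex
  Hilbert space are its complex-linear members. The norm and the topology agree.
\<close>

type_synonym oper = "ell2 \<Rightarrow>\<^sub>L ell2"

definition complex_linear :: "oper \<Rightarrow> bool"
  where "complex_linear T \<longleftrightarrow> (\<forall>c x. T (c *\<^sub>C x) = c *\<^sub>C T x)"

lemma norm_scaleC: "norm (c *\<^sub>C x) = cmod c * norm x"
  by (simp add: norm_ell2_eq scaleC.rep_eq norm_mult power_mult_distrib
      suminf_mult[OF coord_summable] real_sqrt_mult)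

lemma bounded_linear_scaleC: "bounded_linear (\<lambda>x. c *\<^sub>C x)"
proof (rule bounded_linear_intro)
  show "norm (c *\<^sub>C x) \<le> norm x * cmod c" for x
    by (simp add: norm_scaleC)
  show "c *\<^sub>C (r *\<^sub>R x) = r *\<^sub>R c *\<^sub>C x" for r x
    by (simp add: scaleR_ell2_def ell2.scale_left_commute)
qed (rule ell2.scale_right_distrib)

definition op_scale :: "complex \<Rightarrow> oper \<Rightarrow> oper"
  where "op_scale c T = Blinfun (\<lambda>x. c *\<^sub>C T x)"

lemma op_scale_apply: "op_scale c T x = c *\<^sub>C T x"
  unfolding op_scale_def
  by (simp add: bounded_linear_Blinfun_apply bounded_linear_compose[OF bounded_linear_scaleC]
      blinfun.bounded_linear_right)

text \<open>An adjoint in the sense of \<open>adj\<close> exists exactly for the complex-linear operators.\<close>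

definition adj :: "oper \<Rightarrow> oper"
  where "adj T = (THE S :: oper. \<forall>x y. cinner (S x) y = cinner x (T y))"

lemma adj_eqI:
  fixes S T :: oper
  assumes "\<And>x y. cinner (S x) y = cinner x (T y)"
  shows "adj T = S"
  unfolding adj_def
proof (rule the_equality)
  fix R :: oper
  assume R: "\<forall>x y. cinner (R x) y = cinner x (T y)"
  show "R = S"
  proof (rule blinfun_eqI)
    fix x
    have "inner (R x - S x) z = 0" for z
      unfolding inner_diff_left using R assms by (simp add: inner_ell2_def)
    then show "R x = S x"
      using inner_eq_zero_iff[of "R x - S x"] by simp
  qed
qed (use assms in blast)

definition subalgebra :: "oper set \<Rightarrow> bool"
  where "subalgebra B \<longleftrightarrow>
    (\<forall>T\<in>B. complex_linear T) \<and> 0 \<in> B \<and>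
    (\<forall>S\<in>B. \<forall>T\<in>B. S + T \<in> B \<and> S o\<^sub>L T \<in> B) \<and> (\<forall>c. \<forall>T\<in>B. op_scale c T \<in> B)"

definition Cstar_subalgebra :: "oper set \<Rightarrow> bool"
  where "Cstar_subalgebra B \<longleftrightarrow> subalgebra B \<and> (\<forall>T\<in>B. adj T \<in> B) \<and> closed B"

definition star_automorphism :: "oper set \<Rightarrow> (oper \<Rightarrow> oper) \<Rightarrow> bool"
  where "star_automorphism B r \<longleftrightarrow> bij_betw r B B \<and>
    (\<forall>S\<in>B. \<forall>T\<in>B. r (S + T) = r S + r T \<and> r (S o\<^sub>L T) = r S o\<^sub>L r T) \<and>
    (\<forall>c. \<forall>T\<in>B. r (op_scale c T) = op_scale c (r T)) \<and>
    (\<forall>T\<in>B. r (adj T) = adj (r T))"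


section \<open>The Toeplitz algebra and its derivations\<close>

lemma case_nat_summable:
  "summable (\<lambda>k. (cmod (case_nat 0 f k))\<^sup>2)" if "summable (\<lambda>k. (cmod (f k))\<^sup>2)"
  using that summable_Suc_iff[of "\<lambda>k. (cmod (case_nat 0 f k))\<^sup>2"] by simp

lift_definition shift :: "ell2 \<Rightarrow> ell2" is "case_nat 0"
  by (rule case_nat_summable)

definition U :: oper
  where "U = Blinfun shift"

lemma U_apply: "blinfun_apply U = shift"
  unfolding U_def
proof (rule bounded_linear_Blinfun_apply, rule bounded_linear_intro)
  fix x y :: ell2 and r :: real
  show "shift (x + y) = shift x + shift y"
    by transfer (simp add: fun_eq_iff split: nat.split)
  show "shift (r *\<^sub>R x) = r *\<^sub>R shift x"
    unfolding scaleR_ell2_def by transfer (simp add: fun_eq_iff split: nat.split)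
  show "norm (shift x) \<le> norm x * 1"
    using suminf_split_head[OF coord_summable[of "shift x"]]
    by (simp add: norm_ell2_eq shift.rep_eq)
qed

lemma U_E: "U (E k) = E (Suc k)"
  unfolding U_apply by transfer (simp add: fun_eq_iff split: nat.split)

lift_definition backshift :: "ell2 \<Rightarrow> ell2" is "\<lambda>x k. x (Suc k)"
proof -
  fix x :: "nat \<Rightarrow> complex"
  assume "summable (\<lambda>k. (cmod (x k))\<^sup>2)"
  then show "summable (\<lambda>k. (cmod (x (Suc k)))\<^sup>2)"
    using summable_Suc_iff[of "\<lambda>k. (cmod (x k))\<^sup>2"] by simp
qed

lemma adj_U: "blinfun_apply (adj U) = backshift"
proof -
  have "bounded_linear backshift"
  proof (rule bounded_linear_intro)
    fix x y :: ell2 and r :: real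
    show "backshift (x + y) = backshift x + backshift y"
      by transfer simp
    show "backshift (r *\<^sub>R x) = r *\<^sub>R backshift x"
      unfolding scaleR_ell2_def by transfer simp
    show "norm (backshift x) \<le> norm x * 1"
      using suminf_split_head[OF coord_summable[of x]]
      by (simp add: norm_ell2_eq backshift.rep_eq)
  qed
  then have B: "blinfun_apply (Blinfun backshift) = backshift"
    by (rule bounded_linear_Blinfun_apply)
  have "cinner (backshift x) y = cinner x (U y)" for x y
    using suminf_split_head[OF cinner_summable[of x "U y"]]
    by (simp add: cinner_def U_apply shift.rep_eq backshift.rep_eq)
  then have "adj U = Blinfun backshift"
    by (intro adj_eqI) (simp add: B)
  then show ?thesis using B by simp
qed

definition Pol :: "oper set"
  where "Pol = subalgebra hull {id_blinfun, U, adj U}"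

definition Toeplitz :: "oper set"
  where "Toeplitz = Cstar_subalgebra hull {U}"

definition derivation :: "(oper \<Rightarrow> oper) \<Rightarrow> bool"
  where "derivation d \<longleftrightarrow> d ` Pol \<subseteq> Toeplitz \<and>
    (\<forall>a\<in>Pol. \<forall>b\<in>Pol. d (a + b) = d a + d b) \<and>
    (\<forall>c. \<forall>a\<in>Pol. d (op_scale c a) = op_scale c (d a)) \<and>
    (\<forall>a\<in>Pol. \<forall>b\<in>Pol. d (a o\<^sub>L b) = (a o\<^sub>L d b) + (d a o\<^sub>L b))"

text \<open>\<open>pred_val \<beta> k\<close> is $\beta(k-1)$ with the convention $\beta(-1) = 0$.\<close>

definition pred_val :: "(nat \<Rightarrow> complex) \<Rightarrow> nat \<Rightarrow> complex"
  where "pred_val \<beta> = case_nat 0 \<beta>"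

definition c_inc :: "(nat \<Rightarrow> complex) set"
  where "c_inc = {\<beta>. convergent (\<lambda>k. \<beta> k - pred_val \<beta> k)}"

definition eventually_linear :: "(nat \<Rightarrow> complex) \<Rightarrow> bool"
  where "eventually_linear \<beta> \<longleftrightarrow> (\<exists>c. \<forall>\<^sub>F k in sequentially. \<beta> k - pred_val \<beta> k = c)"

text \<open>
  The diagonal operator may be unbounded. Its value is meaningful only at those \<open>x\<close> for which
  the sequence on the right is square-summable, in particular on the span of the \<open>E k\<close>.
\<close>

definition diag :: "(nat \<Rightarrow> complex) \<Rightarrow> ell2 \<Rightarrow> ell2"
  where "diag g x = Abs_ell2 (\<lambda>k. g k * coord x k)"

lemma diag_E: "diag g (E k) = g k *\<^sub>C E k"
proof -
  have "(\<lambda>j. g j * coord (E k) j) = coord (g k *\<^sub>C E k)"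
    by (auto simp: E.rep_eq scaleC.rep_eq)
  then show ?thesis
    by (simp add: diag_def coord_inverse)
qed

text \<open>
  \<open>T\<close> is the bounded operator given by the commutator of \<open>D\<close> and \<open>a\<close> on the span of the \<open>E k\<close>.
  Elements of \<open>Pol\<close> map this span to itself.
\<close>

definition is_commutator :: "oper \<Rightarrow> (ell2 \<Rightarrow> ell2) \<Rightarrow> oper \<Rightarrow> bool"
  where "is_commutator T D a \<longleftrightarrow> (\<forall>x\<in>cspan (range E). T x = D (a x) - a (D x))"

end

theory Submission
  imports Defs
begin

text \<open>
  A derivation is determined by its values on the generators $U$ and $U^*$. Invariance forces
  $d(U)$ to be homogeneous of degree one for the gauge action, so that its matrix is
  concentrated on the first subdiagonal: $d(U) E_k = \gamma_k E_{k+1}$. Differentiating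
  $U^* U = 1$ then gives $d(U^*) E_{k+1} = -\gamma_k E_k$, while $d(U^*) E_0 = 0$ by homogeneity.
  These are exactly the commutators of $U$ and $U^*$ with $\beta(\mathbb{K}-1)$ when the
  increments of $\beta$ are the $\gamma_k$, that is, when $\beta(k) = \sum_{i \le k} \gamma_i$;
  since both sides are derivations, they agree on all polynomials
  (\<open>invariant_derivation_is_commutator\<close>). Conversely the value at $U$ gives back the
  increments of $\beta$, and together with $\beta(-1) = 0$ this is uniqueness
  (\<open>commutator_U_increment\<close>, \<open>increments_determine\<close>).

  The behaviour of the increments at infinity expresses where $d(U)$ lies. If $T$ is a polynomial,
  then $T U^N$ commutes with $U$ for large $N$, because $U^* U = 1$ lets enough factors $U$ on the
  right cancel every $U^*$; hence the diagonals of $T$ are eventually constant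
  (\<open>Pol_diagonal_eventually_constant\<close>). This is the last claim. The Toeplitz algebra is
  contained in the norm closure of the polynomials, and matrix entries are bounded by the norm, so
  for $T$ in the Toeplitz algebra the diagonals are Cauchy
  (\<open>Toeplitz_diagonal_convergent\<close>), whence $\beta$ has convergent increments.

  Homogeneity in terms of matrix entries can be read off without knowing that the
  automorphisms $\rho_\theta$ are continuous or spatially implemented. With the rank-one
  projection $P = 1 - U U^*$ one has $P U^{*j} T U^k P = T_{jk} P$, and an automorphism that
  rotates $U$ fixes $P$ and multiplies the two powers by phases (\<open>gauge_matrix_entry\<close>).
\<close>

section \<open>Coordinates and completeness of the Hilbert space\<close>

lemma coord_simps [simp]:
  "coord (x + y) k = coord x k + coord y k"
  "coord (x - y) k = coord x k - coord y k"
  "coord (- x) k = - coord x k"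
  "coord 0 k = 0"
  "coord (c *\<^sub>C x) k = c * coord x k"
  "coord (E i) k = of_bool (k = i)"
  by (simp_all only: plus_ell2.rep_eq minus_ell2_def uminus_ell2.rep_eq zero_ell2.rep_eq
      scaleC.rep_eq E.rep_eq diff_conv_add_uminus)

lemma ell2_eqI: "(\<And>k. coord x k = coord y k) \<Longrightarrow> x = y"
  by (simp add: coord_inject[symmetric] fun_eq_iff)

lemma norm_ell2_le:
  assumes "\<And>n. (\<Sum>k<n. (cmod (coord x k))\<^sup>2) \<le> e\<^sup>2" and "0 \<le> e"
  shows "norm x \<le> e"
proof -
  have "(\<Sum>k. (cmod (coord x k))\<^sup>2) \<le> e\<^sup>2"
    by (rule suminf_le_const[OF coord_summable assms(1)])
  then show ?thesis
    unfolding norm_ell2_eq by (rule real_le_lsqrt[OF assms(2)])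
qed

lemma sum_coord_le_norm:
  assumes "finite F"
  shows "(\<Sum>k\<in>F. (cmod (coord x k))\<^sup>2) \<le> (norm x)\<^sup>2"
proof -
  have "(norm x)\<^sup>2 = (\<Sum>k. (cmod (coord x k))\<^sup>2)"
    unfolding norm_ell2_eq
    by (intro real_sqrt_pow2 suminf_nonneg coord_summable) simp
  then show ?thesis
    using sum_le_suminf[OF coord_summable assms, of x] by simp
qed

lemma coord_le_norm: "cmod (coord x k) \<le> norm x"
  using sum_coord_le_norm[of "{k}" x] by (simp add: power2_le_iff_abs_le)

text \<open>
  The coordinatewise limit of a Cauchy sequence is its limit in norm: the Cauchy estimate for
  finitely many coordinates survives the passage to the limit in one index, uniformly in the
  number of coordinates. Completeness is what provides adjoints of norm limits of operators.
\<close>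

instance ell2 :: banach
proof
  fix X :: "nat \<Rightarrow> ell2"
  assume X: "Cauchy X"
  have "Cauchy (\<lambda>n. coord (X n) k)" for k
  proof (rule CauchyI)
    fix e :: real
    assume "0 < e"
    from CauchyD[OF X this] obtain M where M: "\<forall>m\<ge>M. \<forall>n\<ge>M. norm (X m - X n) < e" ..
    have "cmod (coord (X m) k - coord (X n) k) \<le> norm (X m - X n)" for m n
      using coord_le_norm[of "X m - X n" k] by simp
    then show "\<exists>M. \<forall>m\<ge>M. \<forall>n\<ge>M. norm (coord (X m) k - coord (X n) k) < e"
      using M by (meson le_less_trans)
  qed
  then have "\<exists>l. (\<lambda>n. coord (X n) k) \<longlonglongrightarrow> l" for k
    using Cauchy_convergent convergent_def by blast
  then obtain y where y: "\<And>k. (\<lambda>n. coord (X n) k) \<longlonglongrightarrow> y k"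
    by metis
  have tail: "(\<Sum>k<N. (cmod (coord (X m) k - y k))\<^sup>2) \<le> e\<^sup>2"
    if M: "\<forall>m\<ge>M. \<forall>n\<ge>M. norm (X m - X n) < e" and m: "m \<ge> M" for M m N e
  proof (rule tendsto_upperbound[OF _ _ sequentially_bot])
    show "(\<lambda>n. \<Sum>k<N. (cmod (coord (X m) k - coord (X n) k))\<^sup>2)
        \<longlonglongrightarrow> (\<Sum>k<N. (cmod (coord (X m) k - y k))\<^sup>2)"
      by (intro tendsto_intros y)
    have "(\<Sum>k<N. (cmod (coord (X m) k - coord (X n) k))\<^sup>2) \<le> e\<^sup>2" if n: "n \<ge> M" for n
    proof -
      have "(\<Sum>k<N. (cmod (coord (X m) k - coord (X n) k))\<^sup>2) \<le> (norm (X m - X n))\<^sup>2"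
        using sum_coord_le_norm[of "{..<N}" "X m - X n"] by simp
      also have "\<dots> \<le> e\<^sup>2"
        using M m n by (intro power_mono) (auto intro: less_imp_le)
      finally show ?thesis .
    qed
    then show "\<forall>\<^sub>F n in sequentially. (\<Sum>k<N. (cmod (coord (X m) k - coord (X n) k))\<^sup>2) \<le> e\<^sup>2"
      by (auto simp: eventually_sequentially)
  qed
  have "summable (\<lambda>k. (cmod (y k))\<^sup>2)"
  proof -
    from CauchyD[OF X zero_less_one] obtain M
      where M: "\<forall>m\<ge>M. \<forall>n\<ge>M. norm (X m - X n) < 1" ..
    have "summable (\<lambda>k. (cmod (coord (X M) k - y k))\<^sup>2)"
      by (rule summableI_nonneg_bounded[where x = "1\<^sup>2"])
        (use tail[OF M order_refl] in auto)
    then have "summable (\<lambda>k. (cmod (coord (X M) k + - 1 * (coord (X M) k - y k)))\<^sup>2)"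
      by (intro ell2_summable_add ell2_summable_scale coord_summable)
    then show ?thesis by simp
  qed
  then have z: "coord (Abs_ell2 y) = y"
    by (simp add: Abs_ell2_inverse)
  have "X \<longlonglongrightarrow> Abs_ell2 y"
  proof (rule metric_LIMSEQ_I)
    fix r :: real
    assume "0 < r"
    then have "0 < r / 2" by simp
    from CauchyD[OF X this] obtain M
      where M: "\<forall>m\<ge>M. \<forall>n\<ge>M. norm (X m - X n) < r / 2" ..
    have "norm (X m - Abs_ell2 y) \<le> r / 2" if "m \<ge> M" for m
      by (rule norm_ell2_le) (use tail[OF M that] \<open>0 < r\<close> z in simp_all)
    then show "\<exists>M. \<forall>m\<ge>M. dist (X m) (Abs_ell2 y) < r"
      using \<open>0 < r\<close> by (intro exI[of _ M]) (force simp: dist_norm)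
  qed
  then show "convergent X"
    by (auto simp: convergent_def)
qed


section \<open>Complex-linear operators and their adjoints\<close>

lemmas oper_simps =
  blinfun.add_left blinfun.add_right blinfun.diff_left blinfun.diff_right
  blinfun_apply_blinfun_compose op_scale_apply

lemma blinfun_eq_iff: "S = T \<longleftrightarrow> (\<forall>x. blinfun_apply S x = blinfun_apply T x)"
  by (auto intro: blinfun_eqI)

lemma blinfun_compose_assoc: "(R o\<^sub>L S) o\<^sub>L T = R o\<^sub>L (S o\<^sub>L T)"
  by (simp add: blinfun_eq_iff)

lemma blinfun_compose_id [simp]: "T o\<^sub>L id_blinfun = T" "id_blinfun o\<^sub>L T = T"
  by (simp_all add: blinfun_eq_iff)

lemma coord_U: "coord (U x) k = case_nat 0 (coord x) k"
  by (simp add: U_apply shift.rep_eq)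

lemma coord_adj_U: "coord (adj U x) k = coord x (Suc k)"
  by (simp add: adj_U backshift.rep_eq)

lemma U_isometry: "adj U o\<^sub>L U = id_blinfun"
  by (intro blinfun_eqI ell2_eqI) (simp add: coord_U coord_adj_U)

lemma complex_linearD: "complex_linear T \<Longrightarrow> T (c *\<^sub>C x) = c *\<^sub>C T x"
  by (simp add: complex_linear_def)

lemma complex_linear_U: "complex_linear U"
  unfolding complex_linear_def by (auto intro!: ell2_eqI simp: coord_U split: nat.split)

lemma complex_linear_adj_U: "complex_linear (adj U)"
  unfolding complex_linear_def by (auto intro!: ell2_eqI simp: coord_adj_U)

lemma subalgebra_complex_linear: "subalgebra (Collect complex_linear)"
  unfolding subalgebra_def complex_linear_def
  by (simp add: oper_simps ell2.scale_right_distrib ell2.scale_left_commute)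

lemma closed_complex_linear: "closed (Collect complex_linear)"
  unfolding complex_linear_def
  by (intro closed_Collect_all closed_Collect_eq continuous_intros
      bounded_linear.continuous_on[OF bounded_linear_scaleC])

lemma bounded_linear_op_scale: "bounded_linear (op_scale c)"
proof (rule bounded_linear_intro)
  show "op_scale c (S + T) = op_scale c S + op_scale c T" for S T
    by (intro blinfun_eqI) (simp add: oper_simps ell2.scale_right_distrib)
  show "op_scale c (r *\<^sub>R T) = r *\<^sub>R op_scale c T" for r T
    by (intro blinfun_eqI)
      (simp add: oper_simps blinfun.scaleR_left scaleR_ell2_def ell2.scale_left_commute)
  show "norm (op_scale c T) \<le> norm T * cmod c" for T
  proof (rule norm_blinfun_bound)
    show "norm (op_scale c T x) \<le> norm T * cmod c * norm x" for x
      using mult_left_mono[OF norm_blinfun[of T x], of "cmod c"]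
      by (simp add: oper_simps norm_scaleC mult_ac)
  qed simp
qed

text \<open>
  Adjointness is stated with the real inner product. For complex-linear operators this is
  equivalent to adjointness for the complex one, since the imaginary part of the latter is a real
  inner product with a rotated vector.
\<close>

definition adjoint_pair :: "oper \<Rightarrow> oper \<Rightarrow> bool"
  where "adjoint_pair S T \<longleftrightarrow> (\<forall>x y. inner (S x) y = inner x (T y))"

lemma adjoint_pair_sym: "adjoint_pair S T \<longleftrightarrow> adjoint_pair T S"
  unfolding adjoint_pair_def by (metis inner_commute)

lemma cinner_scaleC: "cinner (cnj c *\<^sub>C x) y = cinner x (c *\<^sub>C y)"
  by (simp add: cinner_def mult_ac)

lemma adj_eq_of_adjoint_pair:
  assumes "adjoint_pair S T" and T: "complex_linear T"
  shows "adj T = S"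
proof (rule adj_eqI)
  fix x y
  have Im: "Im (cinner x y) = inner x (- \<i> *\<^sub>C y)" for x y
  proof -
    have "cinner x (- \<i> *\<^sub>C y) = - \<i> * cinner x y"
      unfolding cinner_def suminf_mult[OF cinner_summable, symmetric] by (simp add: mult_ac)
    then show ?thesis by (simp add: inner_ell2_def)
  qed
  show "cinner (S x) y = cinner x (T y)"
  proof (rule complex_eqI)
    show "Re (cinner (S x) y) = Re (cinner x (T y))"
      using assms(1) by (simp add: adjoint_pair_def inner_ell2_def)
    show "Im (cinner (S x) y) = Im (cinner x (T y))"
      using assms(1) by (simp add: Im adjoint_pair_def complex_linearD[OF T])
  qed
qed

lemma adjoint_pair_U: "adjoint_pair (adj U) U"
proof -
  have "cinner (adj U x) y = cinner x (U y)" for x y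
    using suminf_split_head[OF cinner_summable[of x "U y"]]
    by (simp add: cinner_def coord_U coord_adj_U)
  then show ?thesis by (simp add: adjoint_pair_def inner_ell2_def)
qed

lemma adjoint_pair_scale:
  assumes S: "adjoint_pair S T" and T: "complex_linear T"
  shows "adjoint_pair (op_scale (cnj c) S) (op_scale c T)"
proof -
  have "inner (cnj c *\<^sub>C S x) y = inner x (c *\<^sub>C T y)" for x y
  proof -
    have "inner (cnj c *\<^sub>C S x) y = inner (S x) (c *\<^sub>C y)"
      by (simp only: inner_ell2_def cinner_scaleC)
    also have "\<dots> = inner x (c *\<^sub>C T y)"
      using S by (simp add: adjoint_pair_def complex_linearD[OF T])
    finally show ?thesis .
  qed
  then show ?thesis by (simp add: adjoint_pair_def op_scale_apply)
qed

lemma adjoint_pair_norm_le: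
  assumes "adjoint_pair S T"
  shows "norm S \<le> norm T"
proof (rule norm_blinfun_bound)
  fix x
  have "(norm (S x))\<^sup>2 = inner x (T (S x))"
    using assms by (simp add: power2_norm_eq_inner adjoint_pair_def)
  also have "\<dots> \<le> norm x * norm (T (S x))"
    by (rule norm_cauchy_schwarz)
  also have "\<dots> \<le> norm x * (norm T * norm (S x))"
    by (intro mult_left_mono norm_blinfun norm_ge_zero)
  finally have "norm (S x) * norm (S x) \<le> (norm T * norm x) * norm (S x)"
    by (simp add: power2_eq_square mult_ac)
  then show "norm (S x) \<le> norm T * norm x"
    by (cases "norm (S x) = 0") (auto simp: mult_le_cancel_right)
qed simp

text \<open>
  Passing to the adjoint does not increase norms, so the adjoints of a convergent sequence form a
  Cauchy sequence, and the adjointness relation is preserved by limits.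
\<close>

lemma adjoint_pair_limit:
  assumes pair: "\<And>n. adjoint_pair (S n) (T n)" and lim: "T \<longlonglongrightarrow> T'"
  obtains S' where "S \<longlonglongrightarrow> S'" "adjoint_pair S' T'"
proof -
  have T: "Cauchy T"
    using lim by (rule LIMSEQ_imp_Cauchy)
  have le: "norm (S m - S n) \<le> norm (T m - T n)" for m n
    by (rule adjoint_pair_norm_le)
      (use pair in \<open>simp add: adjoint_pair_def oper_simps inner_diff_left inner_diff_right\<close>)
  have "Cauchy S"
  proof (rule CauchyI)
    fix e :: real
    assume "0 < e"
    from CauchyD[OF T this] show "\<exists>M. \<forall>m\<ge>M. \<forall>n\<ge>M. norm (S m - S n) < e"
      using le by (meson le_less_trans)
  qed
  then obtain S' where S': "S \<longlonglongrightarrow> S'"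
    using Cauchy_convergent convergent_def by blast
  have "inner (S' x) y = inner x (T' y)" for x y
  proof (rule LIMSEQ_unique)
    show "(\<lambda>n. inner (S n x) y) \<longlonglongrightarrow> inner (S' x) y"
      by (intro tendsto_intros S')
    show "(\<lambda>n. inner (S n x) y) \<longlonglongrightarrow> inner x (T' y)"
      using pair by (simp add: adjoint_pair_def) (intro tendsto_intros lim)
  qed
  with S' show ?thesis
    by (intro that) (auto simp: adjoint_pair_def)
qed


section \<open>The Toeplitz algebra as the closure of the polynomials\<close>

lemma subalgebraD:
  assumes "subalgebra B"
  shows "T \<in> B \<Longrightarrow> complex_linear T" "0 \<in> B"
    "S \<in> B \<Longrightarrow> T \<in> B \<Longrightarrow> S + T \<in> B" "S \<in> B \<Longrightarrow> T \<in> B \<Longrightarrow> S o\<^sub>L T \<in> B"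
    "T \<in> B \<Longrightarrow> op_scale c T \<in> B"
  using assms by (auto simp: subalgebra_def)

lemma subalgebra_Inter:
  assumes "\<And>B. B \<in> F \<Longrightarrow> subalgebra B" "F \<noteq> {}"
  shows "subalgebra (\<Inter>F)"
  using assms unfolding subalgebra_def by blast

lemma Pol_generators: "id_blinfun \<in> Pol" "U \<in> Pol" "adj U \<in> Pol"
  unfolding Pol_def by (auto simp: hull_def)

lemma Pol_subset:
  assumes "subalgebra B" "id_blinfun \<in> B" "U \<in> B" "adj U \<in> B"
  shows "Pol \<subseteq> B"
  unfolding Pol_def by (rule hull_minimal) (use assms in auto)

lemma subalgebra_Pol: "subalgebra Pol"
proof -
  have "complex_linear id_blinfun"
    by (simp add: complex_linear_def)
  then have "Collect complex_linear \<in> {B. subalgebra B \<and> {id_blinfun, U, adj U} \<subseteq> B}"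
    using subalgebra_complex_linear complex_linear_U complex_linear_adj_U by simp
  then show ?thesis
    unfolding Pol_def hull_def by (intro subalgebra_Inter) blast+
qed

text \<open>
  \<^const>\<open>adj\<close> is a definite description, so the existence of adjoints has to be carried along:
  the polynomials that have an adjoint among the polynomials form a subalgebra containing the
  generators.
\<close>

lemma Pol_adjoint:
  assumes "T \<in> Pol"
  obtains S where "S \<in> Pol" "adjoint_pair S T"
proof -
  let ?B = "{T \<in> Pol. \<exists>S\<in>Pol. adjoint_pair S T}"
  note P = subalgebraD[OF subalgebra_Pol]
  have "subalgebra ?B"
    unfolding subalgebra_def
  proof (intro conjI ballI allI)
    show "complex_linear T" if "T \<in> ?B" for T
      using that P(1) by blast
    have "adjoint_pair 0 0"
      by (simp add: adjoint_pair_def)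
    then show "0 \<in> ?B"
      using P(2) by blast
    fix T1 T2
    assume "T1 \<in> ?B" "T2 \<in> ?B"
    then obtain S1 S2 where S: "T1 \<in> Pol" "T2 \<in> Pol" "S1 \<in> Pol" "S2 \<in> Pol"
      and a: "adjoint_pair S1 T1" "adjoint_pair S2 T2"
      by blast
    have "adjoint_pair (S1 + S2) (T1 + T2)" "adjoint_pair (S2 o\<^sub>L S1) (T1 o\<^sub>L T2)"
      using a by (auto simp: adjoint_pair_def oper_simps inner_add_left inner_add_right)
    then show "T1 + T2 \<in> ?B" "T1 o\<^sub>L T2 \<in> ?B"
      using S P(3,4) by blast+
  next
    fix c T
    assume "T \<in> ?B"
    then show "op_scale c T \<in> ?B"
      using P(1,5) adjoint_pair_scale by blast
  qed
  moreover have "adjoint_pair id_blinfun id_blinfun"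
    by (simp add: adjoint_pair_def)
  ultimately have "Pol \<subseteq> ?B"
    using Pol_generators adjoint_pair_U adjoint_pair_sym by (intro Pol_subset) blast+
  with assms that show ?thesis by blast
qed

lemma in_closureI:
  fixes s :: "nat \<Rightarrow> oper"
  shows "(\<And>n. s n \<in> A) \<Longrightarrow> s \<longlonglongrightarrow> l \<Longrightarrow> l \<in> closure A"
  unfolding closure_sequential by blast

text \<open>
  Together with minimality of the Toeplitz algebra this makes every Toeplitz operator a norm limit
  of polynomials. Closure under the adjoint is the one point that needs completeness of the
  Hilbert space.
\<close>

lemma Cstar_subalgebra_closure_Pol: "Cstar_subalgebra (closure Pol)"
  unfolding Cstar_subalgebra_def
proof (intro conjI ballI)
  note P = subalgebraD[OF subalgebra_Pol]
  have "closure Pol \<subseteq> Collect complex_linear"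
    by (rule closure_minimal) (use P(1) closed_complex_linear in auto)
  then have lin: "T \<in> closure Pol \<Longrightarrow> complex_linear T" for T
    by auto
  show "subalgebra (closure Pol)"
    unfolding subalgebra_def
  proof (intro conjI ballI allI)
    show "0 \<in> closure Pol"
      using P(2) closure_subset by blast
    fix S T
    assume "S \<in> closure Pol" "T \<in> closure Pol"
    then obtain s t where st: "\<And>n. s n \<in> Pol" "s \<longlonglongrightarrow> S" "\<And>n. t n \<in> Pol" "t \<longlonglongrightarrow> T"
      unfolding closure_sequential by blast
    show "S + T \<in> closure Pol"
      by (rule in_closureI[OF P(3)[OF st(1,3)] tendsto_add[OF st(2,4)]])
    show "S o\<^sub>L T \<in> closure Pol"
      by (rule in_closureI[OF P(4)[OF st(1,3)]
            bounded_bilinear.tendsto[OF bounded_bilinear_blinfun_compose st(2,4)]])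
  next
    fix c T
    assume "T \<in> closure Pol"
    then obtain t where t: "\<And>n. t n \<in> Pol" "t \<longlonglongrightarrow> T"
      unfolding closure_sequential by blast
    show "op_scale c T \<in> closure Pol"
      by (rule in_closureI[OF P(5)[OF t(1)]
            bounded_linear.tendsto[OF bounded_linear_op_scale t(2)]])
  qed (use lin in blast)
  fix T
  assume T: "T \<in> closure Pol"
  then obtain t where t: "\<And>n. t n \<in> Pol" "t \<longlonglongrightarrow> T"
    unfolding closure_sequential by blast
  have "\<forall>n. \<exists>S. S \<in> Pol \<and> adjoint_pair S (t n)"
    using Pol_adjoint t(1) by blast
  then obtain s where s: "\<And>n. s n \<in> Pol" "\<And>n. adjoint_pair (s n) (t n)"
    by metis
  from adjoint_pair_limit[OF s(2) t(2)] obtain S where S: "s \<longlonglongrightarrow> S" "adjoint_pair S T" .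
  have "adj T = S"
    using S(2) lin[OF T] by (rule adj_eq_of_adjoint_pair)
  then show "adj T \<in> closure Pol"
    using in_closureI[OF s(1) S(1)] by simp
qed simp

lemma Toeplitz_subset_closure_Pol: "Toeplitz \<subseteq> closure Pol"
  unfolding Toeplitz_def
  by (rule hull_minimal)
    (use Cstar_subalgebra_closure_Pol Pol_generators(2) closure_subset in auto)

lemma subalgebra_Toeplitz: "subalgebra Toeplitz"
  unfolding Toeplitz_def hull_def
  by (rule subalgebra_Inter)
    (use Cstar_subalgebra_closure_Pol Pol_generators(2) closure_subset[of Pol]
      in \<open>auto simp: Cstar_subalgebra_def\<close>)

lemma U_in_Toeplitz: "U \<in> Toeplitz"
  unfolding Toeplitz_def by (auto simp: hull_def)

lemma adj_U_in_Toeplitz: "adj U \<in> Toeplitz"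
  unfolding Toeplitz_def by (auto simp: hull_def Cstar_subalgebra_def)


section \<open>Diagonals of Toeplitz operators\<close>

primrec opow :: "oper \<Rightarrow> nat \<Rightarrow> oper"
  where "opow T 0 = id_blinfun"
  | "opow T (Suc n) = T o\<^sub>L opow T n"

lemma opow_add: "opow T (m + n) = opow T m o\<^sub>L opow T n"
  by (induction m) (simp_all add: blinfun_compose_assoc)

lemma opow_commute: "S o\<^sub>L T = T o\<^sub>L S \<Longrightarrow> S o\<^sub>L opow T n = opow T n o\<^sub>L S"
  by (induction n) (simp, metis opow.simps(2) blinfun_compose_assoc)

lemma opow_U_E: "opow U n (E k) = E (n + k)"
  by (induction n) (simp_all add: U_E)

lemma coord_opow_U: "coord (opow U n x) (n + k) = coord x k"
  by (induction n) (simp_all add: coord_U)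

lemma coord_opow_adj_U: "coord (opow (adj U) n x) k = coord x (n + k)"
  by (induction n arbitrary: k) (simp_all add: coord_adj_U)

text \<open>
  The complex-linear operators $T$ such that $T U^N$ commutes with $U$ for some $N$ form an algebra: $N$ may be
  enlarged, which settles sums, and $S T U^{N+M} = (S U^M)(T U^N)$ because $T U^N$ commutes
  with $U^M$. For $U^*$ the exponent $1$ works, as $U^* U = 1$.
\<close>

lemma Pol_commutes_after_shift:
  assumes "T \<in> Pol"
  obtains N where "U o\<^sub>L (T o\<^sub>L opow U N) = (T o\<^sub>L opow U N) o\<^sub>L U"
proof -
  let ?C = "\<lambda>T N. U o\<^sub>L (T o\<^sub>L opow U N) = (T o\<^sub>L opow U N) o\<^sub>L U"
  let ?B = "{T. complex_linear T \<and> (\<exists>N. ?C T N)}"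
  note L = subalgebraD[OF subalgebra_complex_linear]
  have later: "?C T (N + M)" if "?C T N" for T N M
    using that opow_commute[of U U M]
    by (metis opow_add blinfun_compose_assoc)
  have "subalgebra ?B"
    unfolding subalgebra_def
  proof (intro conjI ballI allI)
    show "0 \<in> ?B"
      using L(2) by (auto intro!: exI[of _ 0] blinfun_eqI)
    fix S T
    assume "S \<in> ?B" "T \<in> ?B"
    then obtain M N where lin: "complex_linear S" "complex_linear T"
      and S: "?C S M" and T: "?C T N"
      by blast
    have "?C S (M + N)" "?C T (M + N)"
      using later[OF S, of N] later[OF T, of M] by (simp_all add: add.commute)
    then have "?C (S + T) (M + N)"
      by (simp add: blinfun_eq_iff oper_simps)
    then show "S + T \<in> ?B"
      using L(3)[of S T] lin by blast
    have "(S o\<^sub>L T) o\<^sub>L opow U (N + M) = (S o\<^sub>L opow U M) o\<^sub>L (T o\<^sub>L opow U N)"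
      using opow_commute[OF T[symmetric], of M]
      by (metis opow_add blinfun_compose_assoc)
    then have "?C (S o\<^sub>L T) (N + M)"
      using S T by (metis blinfun_compose_assoc)
    then show "S o\<^sub>L T \<in> ?B"
      using L(4)[of S T] lin by blast
  next
    fix c T
    assume "T \<in> ?B"
    then obtain N where T: "complex_linear T" "?C T N"
      by blast
    then have "?C (op_scale c T) N"
      by (simp add: blinfun_eq_iff oper_simps complex_linearD[OF complex_linear_U])
    then show "op_scale c T \<in> ?B"
      using L(5)[of T c] T(1) by blast
  qed simp
  moreover have "?C id_blinfun 0" "?C U 0"
    by (simp_all add: blinfun_eq_iff)
  moreover have "?C (adj U) 1"
    using U_isometry by (simp add: blinfun_eq_iff)
  moreover have "complex_linear id_blinfun"
    by (simp add: complex_linear_def)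
  ultimately have "Pol \<subseteq> ?B"
    using complex_linear_U complex_linear_adj_U by (intro Pol_subset) blast+
  with assms that show ?thesis by blast
qed

text \<open>
  If $T U^N$ commutes with $U$, then $T E_{N+n} = T U^N U^n E_0 = U^n T E_N$: from column $N$ on,
  the columns of $T$ are shifts of one another.
\<close>

lemma Pol_diagonal_eventually_constant:
  assumes "T \<in> Pol"
  obtains c where "\<forall>\<^sub>F k in sequentially. coord (T (E k)) (k + i) = c"
proof -
  from Pol_commutes_after_shift[OF assms] obtain N
    where N: "U o\<^sub>L (T o\<^sub>L opow U N) = (T o\<^sub>L opow U N) o\<^sub>L U" .
  have "coord (T (E k)) (k + i) = coord (T (E N)) (N + i)" if "k \<ge> N" for k
  proof -
    from that obtain n where k: "k = N + n"
      using le_Suc_ex by blast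
    have "T (E k) = ((T o\<^sub>L opow U N) o\<^sub>L opow U n) (E 0)"
      by (simp add: opow_U_E k)
    also have "\<dots> = opow U n (T (E N))"
      using arg_cong[OF opow_commute[OF N[symmetric], of n], of "\<lambda>S. S (E 0)"]
      by (simp add: opow_U_E)
    finally show ?thesis
      using coord_opow_U[of n "T (E N)" "N + i"] by (simp add: k ac_simps)
  qed
  then show ?thesis
    by (intro that) (auto simp: eventually_sequentially)
qed

lemma norm_E: "norm (E k) = 1"
proof -
  have "(\<lambda>j. (cmod (coord (E k) j))\<^sup>2) sums 1"
    using sums_single[of k "\<lambda>_. 1 :: real"] by (rule sums_cong[THEN iffD1, rotated]) auto
  then show ?thesis
    unfolding norm_ell2_eq by (metis sums_unique real_sqrt_one)
qed

lemma matrix_entry_le: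
  fixes T :: oper
  shows "cmod (coord (T (E k)) j) \<le> norm T"
  using coord_le_norm[of "T (E k)" j] norm_blinfun[of T "E k"] by (simp add: norm_E)

text \<open>
  Up to an arbitrarily small uniform error the diagonal is that of a polynomial, hence eventually
  constant.
\<close>

lemma Toeplitz_diagonal_convergent:
  assumes "T \<in> Toeplitz"
  shows "convergent (\<lambda>k. coord (T (E k)) (k + i))"
proof -
  have "Cauchy (\<lambda>k. coord (T (E k)) (k + i))"
  proof (rule CauchyI)
    fix e :: real
    assume "0 < e"
    then have "0 < e / 2" by simp
    moreover have "T \<in> closure Pol"
      using assms Toeplitz_subset_closure_Pol by blast
    ultimately obtain P where P: "P \<in> Pol" "dist P T < e / 2"
      unfolding closure_approachable by blast
    from Pol_diagonal_eventually_constant[OF P(1), of i]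
    obtain c where "\<forall>\<^sub>F k in sequentially. coord (P (E k)) (k + i) = c" .
    then obtain N where c: "\<And>k. k \<ge> N \<Longrightarrow> coord (P (E k)) (k + i) = c"
      unfolding eventually_sequentially by blast
    have "dist (coord (T (E k)) (k + i)) c < e / 2" if "k \<ge> N" for k
      using matrix_entry_le[of "P - T" k "k + i"] P(2) c[OF that]
      by (simp add: oper_simps dist_norm norm_minus_commute)
    then have "norm (coord (T (E m)) (m + i) - coord (T (E n)) (n + i)) < e"
      if "m \<ge> N" "n \<ge> N" for m n
      using that dist_triangle_half_l by (metis dist_norm)
    then show "\<exists>M. \<forall>m\<ge>M. \<forall>n\<ge>M.
        norm (coord (T (E m)) (m + i) - coord (T (E n)) (n + i)) < e"
      by blast
  qed
  then show ?thesis
    by (rule Cauchy_convergent)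
qed


section \<open>The gauge automorphisms in matrix form\<close>

text \<open>
  The projection onto the line of $E_0$, written as a polynomial in the generators so that the
  action of an automorphism on it can be computed.
\<close>

definition vacuum_proj :: oper
  where "vacuum_proj = id_blinfun + op_scale (- 1) (U o\<^sub>L adj U)"

lemma vacuum_proj_apply: "vacuum_proj x = coord x 0 *\<^sub>C E 0"
  by (rule ell2_eqI)
    (simp add: vacuum_proj_def oper_simps coord_U coord_adj_U split: nat.split)

text \<open>
  A single matrix entry becomes accessible to an algebra homomorphism: it is the scalar that
  represents a corner of $U^{*j} T U^k$.
\<close>

lemma corner_eq_matrix_entry:
  assumes "complex_linear T"
  shows "vacuum_proj o\<^sub>L (opow (adj U) j o\<^sub>L (T o\<^sub>L (opow U k o\<^sub>L vacuum_proj))) =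
    op_scale (coord (T (E k)) j) vacuum_proj"
proof (rule blinfun_eqI)
  fix x
  have "complex_linear (opow U k)"
    using complex_linear_U by (induction k) (simp_all add: complex_linear_def)
  then show "(vacuum_proj o\<^sub>L (opow (adj U) j o\<^sub>L (T o\<^sub>L (opow U k o\<^sub>L vacuum_proj)))) x =
    op_scale (coord (T (E k)) j) vacuum_proj x"
    by (intro ell2_eqI)
      (simp add: oper_simps vacuum_proj_apply coord_opow_adj_U opow_U_E
        complex_linearD[OF assms] complex_linearD[of "opow U k"])
qed

lemma op_scale_compose:
  "op_scale c S o\<^sub>L T = op_scale c (S o\<^sub>L T)"
  "complex_linear S \<Longrightarrow> S o\<^sub>L op_scale c T = op_scale c (S o\<^sub>L T)"
  "op_scale a (op_scale b T) = op_scale (a * b) T"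
  by (intro blinfun_eqI; simp add: oper_simps complex_linearD)+

lemma star_automorphismD:
  assumes "star_automorphism B r"
  shows "S \<in> B \<Longrightarrow> r S \<in> B"
    "S \<in> B \<Longrightarrow> T \<in> B \<Longrightarrow> r (S + T) = r S + r T"
    "S \<in> B \<Longrightarrow> T \<in> B \<Longrightarrow> r (S o\<^sub>L T) = r S o\<^sub>L r T"
    "S \<in> B \<Longrightarrow> r (op_scale c S) = op_scale c (r S)"
  using assms by (auto simp: star_automorphism_def bij_betw_def)

text \<open>
  Apply $r$ to $P U^{*j} T U^k P = T_{jk} P$. As $P$ is fixed, the right-hand side is unchanged,
  while the left-hand side becomes the corresponding corner of $r(T)$ times
  $e^{i(k-j)\theta}$.
\<close>

lemma gauge_matrix_entry:
  assumes aut: "star_automorphism Toeplitz r"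
    and rU: "r U = op_scale (cis \<theta>) U"
    and rU': "r (adj U) = op_scale (cis (- \<theta>)) (adj U)"
    and T: "T \<in> Toeplitz"
  shows "coord (r T (E k)) j = cis ((real j - real k) * \<theta>) * coord (T (E k)) j"
proof -
  note A = subalgebraD[OF subalgebra_Toeplitz]
  note r = star_automorphismD[OF aut]
  have id: "id_blinfun \<in> Toeplitz"
    using A(4)[OF adj_U_in_Toeplitz U_in_Toeplitz] by (simp add: U_isometry)
  have r_id: "r id_blinfun = id_blinfun"
    using r(3)[OF adj_U_in_Toeplitz U_in_Toeplitz]
    by (simp add: U_isometry rU rU' op_scale_compose complex_linear_adj_U cis_mult)
      (simp add: blinfun_eq_iff op_scale_apply)
  have opow_in: "opow S n \<in> Toeplitz" if "S \<in> Toeplitz" for S n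
    by (induction n) (use id that A(4) in auto)
  have r_opow: "r (opow S n) = op_scale (cis (real n * t)) (opow S n)"
    if S: "S \<in> Toeplitz" and rS: "r S = op_scale (cis t) S" for S n t
  proof (induction n)
    case 0
    show ?case by (simp add: r_id blinfun_eq_iff op_scale_apply)
  next
    case (Suc n)
    show ?case
      by (simp add: r(3)[OF S opow_in[OF S]] rS Suc op_scale_compose A(1)[OF S] cis_mult)
        (simp add: algebra_simps)
  qed
  have UU: "U o\<^sub>L adj U \<in> Toeplitz"
    by (rule A(4)[OF U_in_Toeplitz adj_U_in_Toeplitz])
  have P: "vacuum_proj \<in> Toeplitz"
    unfolding vacuum_proj_def by (intro A(3) A(5) id UU)
  have "r (U o\<^sub>L adj U) = op_scale 1 (U o\<^sub>L adj U)"
    by (simp add: r(3) U_in_Toeplitz adj_U_in_Toeplitz rU rU' op_scale_compose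
        complex_linear_U cis_mult)
  then have rP: "r vacuum_proj = vacuum_proj"
    unfolding vacuum_proj_def
    by (simp add: r(2)[OF id A(5)[OF UU]] r(4)[OF UU] r_id op_scale_compose)
  let ?c = "\<lambda>X. vacuum_proj o\<^sub>L (opow (adj U) j o\<^sub>L (X o\<^sub>L (opow U k o\<^sub>L vacuum_proj)))"
  have "r (?c T) = op_scale (cis (real j * - \<theta>) * cis (real k * \<theta>)) (?c (r T))"
    by (simp add: r(3) A(4) P T opow_in U_in_Toeplitz adj_U_in_Toeplitz rP
        r_opow[OF U_in_Toeplitz rU] r_opow[OF adj_U_in_Toeplitz rU'] op_scale_compose
        A(1) r(1) del: cis_mult)
  moreover have "r (?c T) = op_scale (coord (T (E k)) j) vacuum_proj"
    unfolding corner_eq_matrix_entry[OF A(1)[OF T]] by (simp add: r(4) P rP)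
  ultimately have "op_scale (coord (T (E k)) j) vacuum_proj (E 0) =
      op_scale (cis (real j * - \<theta>) * cis (real k * \<theta>) * coord (r T (E k)) j) vacuum_proj (E 0)"
    by (simp add: corner_eq_matrix_entry[OF A(1)[OF r(1)[OF T]]] op_scale_compose)
  from arg_cong[OF this, of "\<lambda>x. coord x 0"]
  have "coord (T (E k)) j = cis ((real k - real j) * \<theta>) * coord (r T (E k)) j"
    by (simp add: op_scale_apply vacuum_proj_apply cis_mult algebra_simps)
  then have "cis ((real j - real k) * \<theta>) * coord (T (E k)) j
      = cis ((real j - real k) * \<theta> + (real k - real j) * \<theta>) * coord (r T (E k)) j"
    by (simp add: cis_mult[symmetric])
  then show ?thesis
    by (simp add: algebra_simps)
qed

text \<open>
  A homogeneous operator of degree $n$ lives on the $n$-th subdiagonal: at any other entry the two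
  phases differ for some angle.
\<close>

lemma gauge_covariant_matrix_entry:
  fixes \<rho> :: "real \<Rightarrow> oper \<Rightarrow> oper" and n :: int
  assumes aut: "\<And>\<theta>. \<theta> \<in> {0..<2 * pi} \<Longrightarrow> star_automorphism Toeplitz (\<rho> \<theta>)"
    and rU: "\<And>\<theta>. \<theta> \<in> {0..<2 * pi} \<Longrightarrow> \<rho> \<theta> U = op_scale (cis \<theta>) U"
    and rU': "\<And>\<theta>. \<theta> \<in> {0..<2 * pi} \<Longrightarrow> \<rho> \<theta> (adj U) = op_scale (cis (- \<theta>)) (adj U)"
    and T: "T \<in> Toeplitz"
    and cov: "\<And>\<theta>. \<theta> \<in> {0..<2 * pi} \<Longrightarrow> \<rho> \<theta> T = op_scale (cis (of_int n * \<theta>)) T"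
    and ne: "int j - int k \<noteq> n"
  shows "coord (T (E k)) j = 0"
proof -
  define m where "m = int j - int k - n"
  \<comment> \<open>an angle at which the two phases are opposite\<close>
  define \<theta> where "\<theta> = pi / \<bar>of_int m\<bar>"
  have m: "m \<noteq> 0"
    using ne by (simp add: m_def)
  then have "1 \<le> \<bar>real_of_int m\<bar>"
    by linarith
  then have "\<theta> \<le> pi"
    unfolding \<theta>_def by (simp add: divide_le_eq)
  moreover have "0 \<le> \<theta>"
    by (simp add: \<theta>_def)
  ultimately have \<theta>: "\<theta> \<in> {0..<2 * pi}"
    using pi_gt_zero by (simp del: pi_gt_zero)
  have "cis (of_int m * \<theta>) = - 1"
    using m by (cases "m > 0") (simp_all add: \<theta>_def cis.ctr complex_eq_iff)
  then have "cis ((real j - real k) * \<theta>) = - cis (of_int n * \<theta>)"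
    using cis_mult[of "of_int m * \<theta>" "of_int n * \<theta>"] by (simp add: m_def algebra_simps)
  moreover have "cis (of_int n * \<theta>) * coord (T (E k)) j
      = cis ((real j - real k) * \<theta>) * coord (T (E k)) j"
    using gauge_matrix_entry[OF aut[OF \<theta>] rU[OF \<theta>] rU'[OF \<theta>] T, of k j]
    by (simp add: cov[OF \<theta>] op_scale_apply)
  ultimately have "2 * (cis (of_int n * \<theta>) * coord (T (E k)) j) = 0"
    by simp
  then show ?thesis
    by (simp add: cis_neq_zero)
qed


section \<open>Commutators with diagonal operators\<close>

lemma finite_support: "x \<in> cspan (range E) \<Longrightarrow> finite {k. coord x k \<noteq> 0}"
proof (induction rule: ell2.span_induct_alt)
  case base
  show ?case by simp
next
  case (step c x y)
  then obtain i where x: "x = E i" by blast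
  have "{k. coord (c *\<^sub>C x + y) k \<noteq> 0} \<subseteq> insert i {k. coord y k \<noteq> 0}"
  proof
    fix k
    assume "k \<in> {k. coord (c *\<^sub>C x + y) k \<noteq> 0}"
    then show "k \<in> insert i {k. coord y k \<noteq> 0}"
      by (cases "k = i") (simp_all add: x)
  qed
  moreover have "finite (insert i {k. coord y k \<noteq> 0})"
    using step.IH by simp
  ultimately show ?case
    by (rule finite_subset)
qed

lemma coord_diag: "x \<in> cspan (range E) \<Longrightarrow> coord (diag g x) k = g k * coord x k"
proof -
  assume "x \<in> cspan (range E)"
  then have "summable (\<lambda>k. (cmod (g k * coord x k))\<^sup>2)"
    by (intro summable_finite[OF finite_support]) auto
  then show ?thesis
    by (simp add: diag_def Abs_ell2_inverse)
qed

lemma diag_add: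
  assumes "x \<in> cspan (range E)" "y \<in> cspan (range E)"
  shows "diag g (x + y) = diag g x + diag g y"
  by (rule ell2_eqI) (simp add: assms ell2.span_add coord_diag distrib_left)

lemma diag_scale:
  assumes "x \<in> cspan (range E)"
  shows "diag g (c *\<^sub>C x) = c *\<^sub>C diag g x"
  by (rule ell2_eqI) (simp add: assms ell2.span_scale coord_diag mult_ac)

lemma span_invariantI:
  assumes T: "complex_linear T" and "\<And>k. T (E k) \<in> cspan (range E)"
    and x: "x \<in> cspan (range E)"
  shows "T x \<in> cspan (range E)"
  using x
proof (induction rule: ell2.span_induct_alt)
  case base
  show ?case by (simp add: ell2.span_zero)
next
  case (step c x y)
  then show ?case
    using assms(2) by (auto simp: oper_simps complex_linearD[OF T]
        intro!: ell2.span_add ell2.span_scale)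
qed

lemma E_in_span: "E k \<in> cspan (range E)"
  by (simp add: ell2.span_base)

lemma diag_zero: "diag g 0 = 0"
  by (rule ell2_eqI) (simp add: coord_diag ell2.span_zero)

text \<open>
  Both sides of the commutator identity are linear on the span of the basis, so that it suffices to
  compare them on basis vectors, where the diagonal operator acts by scalars.
\<close>

lemma is_commutatorI:
  assumes T: "complex_linear T" and a: "complex_linear a"
    and inv: "\<And>k. a (E k) \<in> cspan (range E)"
    and E: "\<And>k. T (E k) = diag g (a (E k)) - g k *\<^sub>C a (E k)"
  shows "is_commutator T (diag g) a"
  unfolding is_commutator_def
proof
  fix x
  assume "x \<in> cspan (range E)"
  then have "x \<in> cspan (range E) \<and> T x = diag g (a x) - a (diag g x)"
  proof (induction rule: ell2.span_induct_alt)
    case base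
    show ?case by (simp add: diag_zero ell2.span_zero)
  next
    case (step c x y)
    then obtain k where x: "x = E k" and y: "y \<in> cspan (range E)"
        and IH: "T y = diag g (a y) - a (diag g y)"
      by blast
    have "diag g (a (c *\<^sub>C x + y)) = c *\<^sub>C diag g (a x) + diag g (a y)"
      using span_invariantI[OF a inv y] inv
      by (simp add: x oper_simps complex_linearD[OF a] diag_add diag_scale ell2.span_scale)
    moreover have "diag g (c *\<^sub>C x + y) = c *\<^sub>C (g k *\<^sub>C x) + diag g y"
      using y by (simp add: x diag_add diag_scale ell2.span_scale E_in_span diag_E)
    ultimately show ?case
      by (simp add: x oper_simps complex_linearD[OF a] complex_linearD[OF T] IH E y
          ell2.scale_right_diff_distrib ell2.span_add ell2.span_scale E_in_span)
  qed
  then show "T x = diag g (a x) - a (diag g x)" ..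
qed

lemma adj_U_E: "adj U (E k) = (case k of 0 \<Rightarrow> 0 | Suc i \<Rightarrow> E i)"
  by (rule ell2_eqI) (auto simp: coord_adj_U split: nat.split)

text \<open>
  A derivation and a commutator satisfy the same Leibniz rule, so agreement passes from the
  generators to the algebra. The product $a b$ needs the identity for $a$ at vectors $b x$; this
  is why the induction also records that polynomials preserve the span of the basis, on which
  alone the diagonal operator is meaningful.
\<close>

lemma derivation_is_commutator:
  assumes d: "derivation d"
    and gen: "is_commutator (d U) (diag g) U" "is_commutator (d (adj U)) (diag g) (adj U)"
    and a: "a \<in> Pol"
  shows "is_commutator (d a) (diag g) a"
proof -
  let ?W = "cspan (range E)"
  let ?B = "{a \<in> Pol. (\<forall>x\<in>?W. a x \<in> ?W) \<and> is_commutator (d a) (diag g) a}"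
  note P = subalgebraD[OF subalgebra_Pol]
  have dadd: "d (a + b) = d a + d b" if "a \<in> Pol" "b \<in> Pol" for a b
    using d that by (simp add: derivation_def)
  have dscale: "d (op_scale c a) = op_scale c (d a)" if "a \<in> Pol" for a c
    using d that by (simp add: derivation_def)
  have dmult: "d (a o\<^sub>L b) = (a o\<^sub>L d b) + (d a o\<^sub>L b)" if "a \<in> Pol" "b \<in> Pol" for a b
    using d that by (simp add: derivation_def)
  have d0: "d 0 = 0"
    using dadd[OF P(2) P(2)] by simp
  have d1: "d id_blinfun = 0"
    using dmult[OF Pol_generators(1,1)] by simp
  have "subalgebra ?B"
    unfolding subalgebra_def
  proof (intro conjI ballI allI)
    show "complex_linear a" if "a \<in> ?B" for a
      using that P(1) by blast
    show "0 \<in> ?B"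
      by (simp add: P(2) is_commutator_def d0 ell2.span_zero diag_zero)
    fix a b
    assume a: "a \<in> ?B" and b: "b \<in> ?B"
    then show "a + b \<in> ?B"
      by (auto simp: P(3) is_commutator_def dadd oper_simps diag_add ell2.span_add)
    show "a o\<^sub>L b \<in> ?B"
      using a b by (auto simp: P(4) is_commutator_def dmult oper_simps)
  next
    fix c a
    assume "a \<in> ?B"
    then show "op_scale c a \<in> ?B"
      by (auto simp: P(5) is_commutator_def dscale oper_simps diag_scale ell2.span_scale
          ell2.scale_right_diff_distrib)
  qed
  moreover have "is_commutator (d id_blinfun) (diag g) id_blinfun"
    by (simp add: d1 is_commutator_def)
  moreover have "U x \<in> ?W" "adj U x \<in> ?W" if "x \<in> ?W" for x
  proof -
    show "U x \<in> ?W"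
      using that by (rule span_invariantI[OF complex_linear_U, rotated]) (simp add: U_E E_in_span)
    show "adj U x \<in> ?W"
      using that by (rule span_invariantI[OF complex_linear_adj_U, rotated])
        (simp add: adj_U_E E_in_span ell2.span_zero split: nat.split)
  qed
  ultimately have "Pol \<subseteq> ?B"
    using Pol_generators gen by (intro Pol_subset) auto
  with a show ?thesis by blast
qed

section \<open>Invariant derivations\<close>

lemma commutator_U_increment:
  assumes "is_commutator T (diag (pred_val \<beta>)) U"
  shows "coord (T (E k)) (Suc k) = \<beta> k - pred_val \<beta> k"
proof -
  have "T (E k) = diag (pred_val \<beta>) (U (E k)) - U (diag (pred_val \<beta>) (E k))"
    using assms E_in_span by (simp add: is_commutator_def)
  then show ?thesis
    by (simp add: U_E diag_E complex_linearD[OF complex_linear_U])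
      (simp add: pred_val_def)
qed

lemma increments_determine:
  assumes "\<And>k. \<beta> k - pred_val \<beta> k = \<gamma> k - pred_val \<gamma> k"
  shows "\<beta> = \<gamma>"
proof
  fix k
  show "\<beta> k = \<gamma> k"
  proof (induction k)
    case 0
    show ?case using assms[of 0] by (simp add: pred_val_def)
  next
    case (Suc k)
    then show ?case using assms[of "Suc k"] by (simp add: pred_val_def)
  qed
qed

text \<open>
  Homogeneity leaves one sequence of entries in $d(U)$ and one in $d(U^*)$; the relation
  $U^* d(U) + d(U^*) U = d(1) = 0$ makes them opposite to each other.
\<close>

lemma invariant_derivation_is_commutator:
  fixes d :: "oper \<Rightarrow> oper" and \<rho> :: "real \<Rightarrow> oper \<Rightarrow> oper"
  assumes aut: "\<And>\<theta>. \<theta> \<in> {0..<2 * pi} \<Longrightarrow> star_automorphism Toeplitz (\<rho> \<theta>)"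
    and rU: "\<And>\<theta>. \<theta> \<in> {0..<2 * pi} \<Longrightarrow> \<rho> \<theta> U = op_scale (cis \<theta>) U"
    and rU': "\<And>\<theta>. \<theta> \<in> {0..<2 * pi} \<Longrightarrow> \<rho> \<theta> (adj U) = op_scale (cis (- \<theta>)) (adj U)"
    and d: "derivation d"
    and invariant: "\<And>\<theta> a. \<theta> \<in> {0..<2 * pi} \<Longrightarrow> a \<in> Pol \<Longrightarrow> \<rho> \<theta> (d a) = d (\<rho> \<theta> a)"
  obtains \<beta> where "\<And>a. a \<in> Pol \<Longrightarrow> is_commutator (d a) (diag (pred_val \<beta>)) a"
proof -
  have dT: "d a \<in> Toeplitz" if "a \<in> Pol" for a
    using d that by (auto simp: derivation_def)
  have dscale: "d (op_scale c a) = op_scale c (d a)" if "a \<in> Pol" for a c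
    using d that by (simp add: derivation_def)
  have dmult: "d (a o\<^sub>L b) = (a o\<^sub>L d b) + (d a o\<^sub>L b)" if "a \<in> Pol" "b \<in> Pol" for a b
    using d that by (simp add: derivation_def)
  have lin: "complex_linear (d a)" if "a \<in> Pol" for a
    using subalgebraD(1)[OF subalgebra_Toeplitz dT[OF that]] .
  note UP = Pol_generators(2) and UP' = Pol_generators(3)
  have dU0: "coord (d U (E k)) j = 0" if "j \<noteq> Suc k" for j k
  proof (rule gauge_covariant_matrix_entry[OF aut rU rU' dT[OF UP], of 1])
    show "\<rho> \<theta> (d U) = op_scale (cis (of_int 1 * \<theta>)) (d U)" if "\<theta> \<in> {0..<2 * pi}" for \<theta>
      using that by (simp add: invariant UP rU dscale)
  qed (use that in auto)
  have dU0': "coord (d (adj U) (E k)) j = 0" if "k \<noteq> Suc j" for j k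
  proof (rule gauge_covariant_matrix_entry[OF aut rU rU' dT[OF UP'], of "- 1"])
    show "\<rho> \<theta> (d (adj U)) = op_scale (cis (of_int (- 1) * \<theta>)) (d (adj U))"
      if "\<theta> \<in> {0..<2 * pi}" for \<theta>
      using that by (simp add: invariant UP' rU' dscale)
  qed (use that in auto)
  define \<gamma> where "\<gamma> k = coord (d U (E k)) (Suc k)" for k
  define \<beta> where "\<beta> k = (\<Sum>i\<le>k. \<gamma> i)" for k
  have \<beta>: "\<beta> k = pred_val \<beta> k + \<gamma> k" for k
    by (cases k) (simp_all add: \<beta>_def pred_val_def)
  have "d id_blinfun = 0"
    using dmult[OF Pol_generators(1,1)] by simp
  then have "(adj U o\<^sub>L d U) + (d (adj U) o\<^sub>L U) = 0"
    using dmult[OF UP' UP] by (simp add: U_isometry)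
  then have "adj U (d U (E k)) + d (adj U) (U (E k)) = 0" for k
    by (metis blinfun.add_left blinfun_apply_blinfun_compose zero_blinfun.rep_eq)
  from arg_cong[OF this, of "\<lambda>x. coord x j" for j]
  have opp: "coord (d (adj U) (E (Suc k))) k = - \<gamma> k" for k
    by (simp add: coord_adj_U U_E \<gamma>_def add_eq_0_iff)
  have "is_commutator (d U) (diag (pred_val \<beta>)) U"
  proof (rule is_commutatorI[OF lin[OF UP] complex_linear_U])
    fix k
    show "U (E k) \<in> cspan (range E)"
      by (simp add: U_E E_in_span)
    have "d U (E k) = \<gamma> k *\<^sub>C E (Suc k)"
      by (rule ell2_eqI) (auto simp: dU0 \<gamma>_def)
    also have "\<dots> = \<beta> k *\<^sub>C E (Suc k) - pred_val \<beta> k *\<^sub>C E (Suc k)"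
      by (rule ell2_eqI) (simp add: \<beta>)
    finally show "d U (E k) = diag (pred_val \<beta>) (U (E k)) - pred_val \<beta> k *\<^sub>C U (E k)"
      by (simp add: U_E diag_E) (simp add: pred_val_def)
  qed
  moreover have "is_commutator (d (adj U)) (diag (pred_val \<beta>)) (adj U)"
  proof (rule is_commutatorI[OF lin[OF UP'] complex_linear_adj_U])
    fix k
    show "adj U (E k) \<in> cspan (range E)"
      by (simp add: adj_U_E E_in_span ell2.span_zero split: nat.split)
    show "d (adj U) (E k) = diag (pred_val \<beta>) (adj U (E k)) - pred_val \<beta> k *\<^sub>C adj U (E k)"
    proof (cases k)
      case 0
      then have "d (adj U) (E k) = 0"
        by (intro ell2_eqI) (simp add: dU0')
      then show ?thesis
        by (simp add: 0 adj_U_E diag_zero)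
    next
      case (Suc i)
      have "d (adj U) (E k) = - \<gamma> i *\<^sub>C E i"
        by (rule ell2_eqI) (use Suc in \<open>auto simp: dU0' opp\<close>)
      also have "\<dots> = pred_val \<beta> i *\<^sub>C E i - \<beta> i *\<^sub>C E i"
        by (rule ell2_eqI) (simp add: \<beta>)
      finally show ?thesis
        by (simp add: Suc adj_U_E diag_E) (simp add: pred_val_def)
    qed
  qed
  ultimately have "is_commutator (d a) (diag (pred_val \<beta>)) a" if "a \<in> Pol" for a
    using derivation_is_commutator[OF d _ _ that] by blast
  then show ?thesis
    by (rule that)
qed

theorem proposition4p1:
  fixes d :: "oper \<Rightarrow> oper" and \<rho> :: "real \<Rightarrow> oper \<Rightarrow> oper"
  assumes rho_aut: "\<And>\<theta>. \<theta> \<in> {0..<2 * pi} \<Longrightarrow> star_automorphism Toeplitz (\<rho> \<theta>)"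
    and rho_U: "\<And>\<theta>. \<theta> \<in> {0..<2 * pi} \<Longrightarrow> \<rho> \<theta> U = op_scale (cis \<theta>) U"
    and rho_adj_U: "\<And>\<theta>. \<theta> \<in> {0..<2 * pi} \<Longrightarrow> \<rho> \<theta> (adj U) = op_scale (cis (- \<theta>)) (adj U)"
    and d: "derivation d"
    and invariant: "\<And>\<theta> a. \<theta> \<in> {0..<2 * pi} \<Longrightarrow> a \<in> Pol \<Longrightarrow> \<rho> \<theta> (d a) = d (\<rho> \<theta> a)"
  shows "(\<exists>!\<beta>. \<beta> \<in> c_inc \<and> (\<forall>a\<in>Pol. is_commutator (d a) (diag (pred_val \<beta>)) a)) \<and>
    (d ` Pol \<subseteq> Pol \<longrightarrow>
      (\<forall>\<beta>. \<beta> \<in> c_inc \<and> (\<forall>a\<in>Pol. is_commutator (d a) (diag (pred_val \<beta>)) a)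
        \<longrightarrow> eventually_linear \<beta>))"
proof (intro conjI impI allI)
  have increment: "\<beta> k - pred_val \<beta> k = coord (d U (E k)) (Suc k)"
    if "\<forall>a\<in>Pol. is_commutator (d a) (diag (pred_val \<beta>)) a" for \<beta> k
    using that Pol_generators(2) commutator_U_increment by metis
  show "\<exists>!\<beta>. \<beta> \<in> c_inc \<and> (\<forall>a\<in>Pol. is_commutator (d a) (diag (pred_val \<beta>)) a)"
  proof (rule ex_ex1I)
    from invariant_derivation_is_commutator[where \<rho> = \<rho> and d = d, OF rho_aut rho_U rho_adj_U d invariant]
    obtain \<beta> where \<beta>: "\<forall>a\<in>Pol. is_commutator (d a) (diag (pred_val \<beta>)) a"
      by metis
    have "d U \<in> Toeplitz"
      using d Pol_generators(2) by (auto simp: derivation_def)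
    from Toeplitz_diagonal_convergent[OF this, of 1] have "\<beta> \<in> c_inc"
      by (simp add: c_inc_def increment[OF \<beta>])
    with \<beta> show "\<exists>\<beta>. \<beta> \<in> c_inc \<and> (\<forall>a\<in>Pol. is_commutator (d a) (diag (pred_val \<beta>)) a)"
      by blast
  next
    fix \<beta> \<gamma>
    assume "\<beta> \<in> c_inc \<and> (\<forall>a\<in>Pol. is_commutator (d a) (diag (pred_val \<beta>)) a)"
      and "\<gamma> \<in> c_inc \<and> (\<forall>a\<in>Pol. is_commutator (d a) (diag (pred_val \<gamma>)) a)"
    then show "\<beta> = \<gamma>"
      by (intro increments_determine) (simp add: increment)
  qed
  fix \<beta>
  assume "d ` Pol \<subseteq> Pol"
    and "\<beta> \<in> c_inc \<and> (\<forall>a\<in>Pol. is_commutator (d a) (diag (pred_val \<beta>)) a)"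
  moreover from this have "d U \<in> Pol"
    using Pol_generators(2) by blast
  from Pol_diagonal_eventually_constant[OF this, of 1] obtain c
    where "\<forall>\<^sub>F k in sequentially. coord (d U (E k)) (k + 1) = c" .
  ultimately show "eventually_linear \<beta>"
    by (auto simp: eventually_linear_def increment)
qed

end
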